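(* Let $K$ be an algebraically closed field with uncountably many elements, let $n\ge 1$, and let $p=(p_i)_{i\in\mathbb{N}}\in\mathbb{A}^n_{\infty}(K)$, i.e. a sequence of points of $\mathbb{A}^n_K(K)=K^n$. Let $V_p\subset\mathbb{A}^n_K$ be the Zariski closure of $\{p_i : i\in\mathbb{N}\}$ and assume that its decomposition into irreducible components has the form $$V_p=V_1\cup\cdots\cup V_r\cup\{v_1\}\cup\cdots\cup\{v_s\}$$ where the sets $V_i(K)$ are infinite and the $v_j$ are closed points of $\mathbb{A}^n_K$. Let $X$ be the orbit closure of $p$. Then the set $X(K)$ of $K$-rational points of $X$ consists exactly of those sequences $(w_i)_{i\in\mathbb{N}}$ in $V_p(K)$ in which each $v_j$ appears at most as often as in $p$, i.e. $|\{i : w_i=v_j\}|\le|\{i: p_i=v_j\}|$ for all $j=1,\dots,s$.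
   Context: Let $S=K[x_{ij}: i\in\mathbb{N}, j\in\{1,\dots,n\}]$ and $\mathbb{A}^n_\infty=\mathbb{A}^n_{K,\infty}=\operatorname{Spec}(S)$. The group $G=\operatorname{Sym}(\infty)=\bigcup_{k}\operatorname{Sym}(k)$ acts on $S$ by $\sigma(x_{ij})=x_{\sigma(i)j}$, hence on $\mathbb{A}^n_\infty$ and on its rational points. $\mathbb{A}^n_\infty(K)=\operatorname{Hom}_K(S,K)$ is identified with the set of sequences $(p_i)_{i\in\mathbb{N}}$ in $K^n$; sending a homomorphism to its kernel gives an injection $\mathbb{A}^n_\infty(K)\to\mathbb{A}^n_\infty$. The orbit closure of a point $x\in\mathbb{A}^n_\infty$ is the Zariski closure of the orbit $Gx=\{\sigma(x):\sigma\in G\}$ in $\mathbb{A}^n_\infty$, with the reduced induced closed subscheme structure; the orbit closure of a rational point is that of its associated point in $\mathbb{A}^n_\infty$. The numbers $|\{i:p_i=v_j\}|$ may be infinite, in which case there is no restriction on the multiplicity of $v_j$. Either of $r,s$ may be $0$. *)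

theory Defs
  imports
    "HOL-Analysis.Abstract_Topology"
    "HOL-Algebra.Algebraic_Closure_Type"
    "HOL-Library.Poly_Mapping"
    "HOL-Library.Countable_Set"
    "HOL-Library.Equipollence"
begin

no_notation Congruence.eq_closure_of (\<open>closure'_of\<index>\<close>)

section \<open>Polynomials in an arbitrary set of variables\<close>

text \<open>
  Polynomials over \<open>'k\<close> in the variables \<open>'v\<close>, possibly infinitely many, as the monoid algebra
  of the free commutative monoid of monomials \<open>'v \<Rightarrow>\<^sub>0 nat\<close>.
\<close>

type_synonym ('v, 'k) mpol = "('v \<Rightarrow>\<^sub>0 nat) \<Rightarrow>\<^sub>0 'k"

definition mpol_const :: "'k::zero \<Rightarrow> ('v, 'k) mpol"
  where "mpol_const c = Poly_Mapping.single 0 c"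

definition mpol_var :: "'v \<Rightarrow> ('v, 'k::zero_neq_one) mpol"
  where "mpol_var v = Poly_Mapping.single (Poly_Mapping.single v 1) 1"

text \<open>If \<open>c\<close> is a ring homomorphism, \<open>mpol_hom c x\<close> is its extension sending the variable \<open>v\<close> to \<open>x v\<close>.\<close>

definition mpol_hom ::
    "('k::comm_ring_1 \<Rightarrow> 'b::comm_ring_1) \<Rightarrow> ('v \<Rightarrow> 'b) \<Rightarrow> ('v, 'k) mpol \<Rightarrow> 'b"
  where "mpol_hom c x f =
    (\<Sum>m\<in>Poly_Mapping.keys f. c (Poly_Mapping.lookup f m) *
       (\<Prod>v\<in>Poly_Mapping.keys m. x v ^ Poly_Mapping.lookup m v))"

definition mpol_eval :: "('v \<Rightarrow> 'k::comm_ring_1) \<Rightarrow> ('v, 'k) mpol \<Rightarrow> 'k"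
  where "mpol_eval x = mpol_hom (\<lambda>a. a) x"

context
  fixes c :: "'k::comm_ring_1 \<Rightarrow> 'b::comm_ring_1"
  assumes c0: "c 0 = 0" and c1: "c 1 = 1"
    and cadd: "\<And>a b. c (a + b) = c a + c b"
    and cmult: "\<And>a b. c (a * b) = c a * c b"
begin

lemma mpol_hom_zero: "mpol_hom c x 0 = 0"
  by (simp add: mpol_hom_def)

lemma mpol_hom_superset:
  assumes "finite A" "Poly_Mapping.keys f \<subseteq> A"
  shows "mpol_hom c x f = (\<Sum>m\<in>A. c (Poly_Mapping.lookup f m) *
       (\<Prod>v\<in>Poly_Mapping.keys m. x v ^ Poly_Mapping.lookup m v))"
  unfolding mpol_hom_def
  by (rule sum.mono_neutral_left) (use assms in \<open>auto simp: in_keys_iff c0\<close>)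

lemma mpol_hom_add: "mpol_hom c x (f + g) = mpol_hom c x f + mpol_hom c x g"
proof -
  let ?A = "Poly_Mapping.keys f \<union> Poly_Mapping.keys g"
  have *: "finite ?A" by simp
  show ?thesis
    using mpol_hom_superset[OF *, of f x] mpol_hom_superset[OF *, of g x]
      mpol_hom_superset[OF * keys_add, of x]
    by (simp add: lookup_add cadd distrib_right sum.distrib)
qed

lemma mpol_hom_single:
  "mpol_hom c x (Poly_Mapping.single m a) =
     c a * (\<Prod>v\<in>Poly_Mapping.keys m. x v ^ Poly_Mapping.lookup m v)"
  by (cases "a = 0") (auto simp: mpol_hom_def c0)

lemma mpol_hom_const: "mpol_hom c x (mpol_const a) = c a"
  by (simp add: mpol_const_def mpol_hom_single)

lemma mpol_hom_var: "mpol_hom c x (mpol_var v) = x v"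
  by (simp add: mpol_var_def mpol_hom_single c1)

lemma mpol_hom_one: "mpol_hom c x 1 = 1"
  using mpol_hom_const[of x 1] by (simp add: mpol_const_def c1)

lemma monom_prod_superset:
  assumes "finite A" "Poly_Mapping.keys m \<subseteq> A"
  shows "(\<Prod>v\<in>Poly_Mapping.keys m. (x v :: 'b) ^ Poly_Mapping.lookup m v) =
         (\<Prod>v\<in>A. x v ^ Poly_Mapping.lookup m v)"
  by (rule prod.mono_neutral_left) (use assms in \<open>auto simp: in_keys_iff\<close>)

lemma mpol_hom_mult_single:
  "mpol_hom c x (Poly_Mapping.single m a * Poly_Mapping.single l b) =
   mpol_hom c x (Poly_Mapping.single m a) * mpol_hom c x (Poly_Mapping.single l b)"
proof -
  let ?A = "Poly_Mapping.keys m \<union> Poly_Mapping.keys l"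
  have *: "finite ?A" by simp
  show ?thesis
    using monom_prod_superset[OF *, of m x] monom_prod_superset[OF *, of l x]
      monom_prod_superset[OF * keys_add, of x]
    by (simp add: mult_single mpol_hom_single cmult lookup_add power_add prod.distrib)
qed

end

lemma mpol_induct [case_names zero add_single]:
  fixes f :: "('v, 'k::comm_ring_1) mpol"
  assumes "P 0" "\<And>f m a. P f \<Longrightarrow> P (f + Poly_Mapping.single m a)"
  shows "P f"
proof (induction f rule: update_induct)
  case const
  show ?case by (fact assms(1))
next
  case (update f a b)
  have "Poly_Mapping.update a b f = f + Poly_Mapping.single a b"
    using update(1)
    by (intro poly_mapping_eqI) (auto simp: lookup_update lookup_add lookup_single in_keys_iff when_def)
  then show ?case using assms(2)[OF update(3)] by simp
qed

lemma mpol_hom_mult: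
  fixes c :: "'k::comm_ring_1 \<Rightarrow> 'b::comm_ring_1"
  assumes c: "c 0 = 0" "c 1 = 1" "\<And>a b. c (a + b) = c a + c b" "\<And>a b. c (a * b) = c a * c b"
  shows "mpol_hom c x (f * g) = mpol_hom c x f * mpol_hom c x g"
proof (induction f rule: mpol_induct)
  case zero
  show ?case by (simp add: mpol_hom_zero[of c, OF c])
next
  case (add_single f m a)
  have "mpol_hom c x (Poly_Mapping.single m a * g) =
        mpol_hom c x (Poly_Mapping.single m a) * mpol_hom c x g"
    by (induction g rule: mpol_induct)
      (auto simp: mpol_hom_zero[of c, OF c] mpol_hom_add[of c, OF c] mpol_hom_mult_single[of c, OF c] distrib_left)
  then show ?case using add_single by (simp add: mpol_hom_add[of c, OF c] distrib_right)
qed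

lemma mpol_eval_simps [simp]:
  fixes x :: "'v \<Rightarrow> 'k::comm_ring_1"
  shows
  "mpol_eval x 0 = 0" "mpol_eval x 1 = 1"
  "mpol_eval x (f + g) = mpol_eval x f + mpol_eval x g"
  "mpol_eval x (f * g) = mpol_eval x f * mpol_eval x g"
  "mpol_eval x (mpol_const a) = a" "mpol_eval x (mpol_var v) = x v"
  unfolding mpol_eval_def
proof -
  have id: "(0::'k) = 0" "(1::'k) = 1" "\<And>a b :: 'k. a + b = a + b" "\<And>a b :: 'k. a * b = a * b"
    by simp_all
  let ?c = "\<lambda>a :: 'k. a"
  show "mpol_hom ?c x 0 = 0" by (rule mpol_hom_zero[of ?c, OF id])
  show "mpol_hom ?c x 1 = 1" by (rule mpol_hom_one[of ?c, OF id])
  show "mpol_hom ?c x (f + g) = mpol_hom ?c x f + mpol_hom ?c x g" by (rule mpol_hom_add[of ?c, OF id])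
  show "mpol_hom ?c x (f * g) = mpol_hom ?c x f * mpol_hom ?c x g" by (rule mpol_hom_mult[of ?c, OF id])
  show "mpol_hom ?c x (mpol_const a) = a" by (rule mpol_hom_const[of ?c, OF id])
  show "mpol_hom ?c x (mpol_var v) = x v" by (rule mpol_hom_var[of ?c, OF id])
qed


section \<open>The spectrum of a commutative ring and its Zariski topology\<close>

definition Spec :: "'a::comm_ring_1 set set"
  where "Spec = {P. primeideal P ring_of_type_algebra}"

definition zariski :: "'a::comm_ring_1 set topology"
  where "zariski = topology (\<lambda>U. \<exists>E. U = {P \<in> Spec. \<not> E \<subseteq> P})"

lemma istopology_zariski:
  "istopology (\<lambda>U. \<exists>E. U = {P \<in> (Spec :: 'a::comm_ring_1 set set). \<not> E \<subseteq> P})"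
  unfolding istopology_def
proof (intro conjI allI impI)
  fix S T :: "'a set set"
  assume "\<exists>E. S = {P \<in> Spec. \<not> E \<subseteq> P}" "\<exists>E. T = {P \<in> Spec. \<not> E \<subseteq> P}"
  then obtain E F where S: "S = {P \<in> Spec. \<not> E \<subseteq> P}" and T: "T = {P \<in> Spec. \<not> F \<subseteq> P}"
    by blast
  have prime: "a * b \<in> P \<longleftrightarrow> a \<in> P \<or> b \<in> P" if "P \<in> Spec" for P :: "'a set" and a b
  proof -
    interpret primeideal P "ring_of_type_algebra" using that by (simp add: Spec_def)
    show ?thesis
      using I_prime[of a b] I_l_closed[of b a] I_r_closed[of a b]
      by (auto simp: ring_of_type_algebra_def)
  qed
  have "S \<inter> T = {P \<in> Spec. \<not> {a * b | a b. a \<in> E \<and> b \<in> F} \<subseteq> P}"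
    unfolding S T using prime by blast
  then show "\<exists>E. S \<inter> T = {P \<in> Spec. \<not> E \<subseteq> P}" by blast
next
  fix \<U> :: "'a set set set"
  assume "\<forall>U\<in>\<U>. \<exists>E. U = {P \<in> Spec. \<not> E \<subseteq> P}"
  from bchoice[OF this]
  obtain E where E: "\<And>U. U \<in> \<U> \<Longrightarrow> U = {P \<in> Spec. \<not> E U \<subseteq> P}"
    by blast
  have "P \<in> U \<longleftrightarrow> P \<in> Spec \<and> \<not> E U \<subseteq> P" if "U \<in> \<U>" for P U
    by (subst E[OF that]) simp
  then have "P \<in> \<Union>\<U> \<longleftrightarrow> P \<in> {P \<in> Spec. \<not> (\<Union>U\<in>\<U>. E U) \<subseteq> P}" for P
    by (simp add: UN_subset_iff Bex_def)
  then have "\<Union>\<U> = {P \<in> Spec. \<not> (\<Union>U\<in>\<U>. E U) \<subseteq> P}"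
    by (rule Set.set_eqI)
  then show "\<exists>E. \<Union>\<U> = {P \<in> Spec. \<not> E \<subseteq> P}" by blast
qed

lemma openin_zariski: "openin zariski U \<longleftrightarrow> (\<exists>E. U = {P \<in> Spec. \<not> E \<subseteq> P})"
  unfolding zariski_def by (simp add: topology_inverse'[OF istopology_zariski])

lemma topspace_zariski: "topspace zariski = (Spec :: 'a::comm_ring_1 set set)"
proof -
  have "openin zariski (Spec :: 'a set set)"
    unfolding openin_zariski
  proof (intro exI[of _ UNIV] equalityI subsetI CollectI conjI)
    fix P :: "'a set"
    assume P: "P \<in> Spec"
    then interpret primeideal P "ring_of_type_algebra" by (simp add: Spec_def)
    show "\<not> UNIV \<subseteq> P" using I_notcarr by (auto simp: ring_of_type_algebra_def)
  qed auto
  then have "(Spec :: 'a set set) \<subseteq> topspace zariski" by (rule openin_subset)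
  moreover have "topspace zariski \<subseteq> (Spec :: 'a set set)"
    using openin_topspace[of "zariski :: 'a set topology"] unfolding openin_zariski by blast
  ultimately show ?thesis by blast
qed

lemma closedin_zariski: "closedin zariski C \<longleftrightarrow> (\<exists>E. C = {P \<in> Spec. E \<subseteq> P})"
proof
  assume "closedin zariski C"
  then have C: "C \<subseteq> Spec" "\<exists>E. Spec - C = {P \<in> Spec. \<not> E \<subseteq> P}"
    by (simp_all only: closedin_def topspace_zariski openin_zariski)
  from C(2) obtain E where E: "Spec - C = {P \<in> Spec. \<not> E \<subseteq> P}" ..
  have "C = Spec - (Spec - C)" using C(1) by blast
  also have "\<dots> = {P \<in> Spec. E \<subseteq> P}" unfolding E by blast
  finally show "\<exists>E. C = {P \<in> Spec. E \<subseteq> P}" by (rule exI)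
next
  assume "\<exists>E. C = {P \<in> Spec. E \<subseteq> P}"
  then obtain E where C: "C = {P \<in> Spec. E \<subseteq> P}" ..
  have "Spec - C = {P \<in> Spec. \<not> E \<subseteq> P}" unfolding C by blast
  then have "\<exists>E. Spec - C = {P \<in> Spec. \<not> E \<subseteq> P}" by (rule exI)
  moreover have "C \<subseteq> Spec" unfolding C by blast
  ultimately show "closedin zariski C"
    by (simp only: closedin_def topspace_zariski openin_zariski)
qed


section \<open>Irreducible components\<close>

definition irreducible_in :: "'a topology \<Rightarrow> 'a set \<Rightarrow> bool"
  where "irreducible_in T S \<longleftrightarrow> S \<subseteq> topspace T \<and> S \<noteq> {} \<and>
    (\<forall>A B. closedin T A \<longrightarrow> closedin T B \<longrightarrow> S \<subseteq> A \<union> B \<longrightarrow> S \<subseteq> A \<or> S \<subseteq> B)"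

definition irreducible_components :: "'a topology \<Rightarrow> 'a set \<Rightarrow> 'a set set"
  where "irreducible_components T Y =
    {S. S \<subseteq> Y \<and> irreducible_in T S \<and>
        (\<forall>S'. S \<subseteq> S' \<longrightarrow> S' \<subseteq> Y \<longrightarrow> irreducible_in T S' \<longrightarrow> S' = S)}"


section \<open>Rational points of affine spaces\<close>

text \<open>
  The affine space with coordinates indexed by \<open>'v\<close> is \<open>Spec\<close> of the ring \<open>('v, 'k) mpol\<close>. A
  \<open>'k\<close>-algebra homomorphism from this ring to \<open>'k\<close> is the same as a function \<open>x :: 'v \<Rightarrow> 'k\<close> (the values
  at the variables), and \<open>kpoint x\<close> is its kernel.
\<close>

definition kpoint :: "('v \<Rightarrow> 'k::comm_ring_1) \<Rightarrow> ('v, 'k) mpol set"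
  where "kpoint x = {f. mpol_eval x f = 0}"

text \<open>
  \<open>kpoints Y\<close> is the set of \<open>'k\<close>-rational points of a closed set \<open>Y\<close> with its reduced induced scheme
  structure: as \<open>Spec 'k\<close> is a reduced one-point space, a rational point of the affine space factors
  through \<open>Y\<close> iff its image lies in \<open>Y\<close>.
\<close>

definition kpoints :: "('v, 'k::comm_ring_1) mpol set set \<Rightarrow> ('v \<Rightarrow> 'k) set"
  where "kpoints Y = {x. kpoint x \<in> Y}"

lemma kpoint_in_Spec: "kpoint (x :: 'v \<Rightarrow> 'k::field) \<in> Spec"
proof -
  have neg: "mpol_eval x (- f) = - mpol_eval x f" for f
    using mpol_eval_simps(3)[of x f "- f"] by (simp add: eq_neg_iff_add_eq_0 add.commute)
  let ?R = "ring_of_type_algebra :: ('v, 'k) mpol ring"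
  interpret cring ?R by (rule cring_from_type_algebra)
  have inv: "\<ominus>\<^bsub>?R\<^esub> f = - f" for f
    by (rule minus_equality) (auto simp: ring_of_type_algebra_def)
  have "primeideal (kpoint x) ?R"
  proof (rule primeidealI2)
    show "additive_subgroup (kpoint x) ?R"
    proof (intro additive_subgroup.intro group.subgroupI)
      show "group (add_monoid ?R)" by (rule a_group)
      show "kpoint x \<noteq> {}" using mpol_eval_simps(1)[of x] by (auto simp: kpoint_def simp del: mpol_eval_simps)
      show "inv\<^bsub>add_monoid ?R\<^esub> a \<in> kpoint x" if "a \<in> kpoint x" for a
        using that inv[of a] by (simp add: a_inv_def kpoint_def neg)
    qed (auto simp: ring_of_type_algebra_def kpoint_def)
    have "(1 :: ('v, 'k) mpol) \<notin> kpoint x" by (simp add: kpoint_def)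
    then show "carrier ?R \<noteq> kpoint x" by (auto simp: ring_of_type_algebra_def)
  qed (auto simp: ring_of_type_algebra_def kpoint_def is_cring[unfolded ring_of_type_algebra_def])
  then show ?thesis by (simp add: Spec_def)
qed


section \<open>The infinite symmetric group and orbit closures\<close>

text \<open>
  The variable \<open>x\<^sub>i\<^sub>j\<close> is indexed by the pair \<open>(i, j)\<close>, so the rational point belonging to a sequence
  \<open>p\<close> of points of \<open>'n \<Rightarrow> 'k\<close> is \<open>case_prod p\<close>, that is \<open>\<lambda>(i, j). p i j\<close>.
\<close>

definition Sym_inf :: "(nat \<Rightarrow> nat) set"
  where "Sym_inf = (\<Union>k. {\<sigma>. \<sigma> permutes {..<k}})"

definition sym_act :: "(nat \<Rightarrow> nat) \<Rightarrow> (nat \<times> 'n, 'k::comm_ring_1) mpol \<Rightarrow> (nat \<times> 'n, 'k) mpol"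
  where "sym_act \<sigma> = mpol_hom mpol_const (\<lambda>(i, j). mpol_var (\<sigma> i, j))"

definition sym_orbit :: "(nat \<times> 'n, 'k::comm_ring_1) mpol set \<Rightarrow> (nat \<times> 'n, 'k) mpol set set"
  where "sym_orbit P = {sym_act \<sigma> ` P | \<sigma>. \<sigma> \<in> Sym_inf}"

definition orbit_closure :: "(nat \<times> 'n, 'k::comm_ring_1) mpol set \<Rightarrow> (nat \<times> 'n, 'k) mpol set set"
  where "orbit_closure P = zariski closure_of sym_orbit P"

lemma mpol_const_hom:
  "mpol_const 0 = 0" "mpol_const 1 = 1" "mpol_const (a + b) = mpol_const a + mpol_const b"
  "mpol_const (a * b) = mpol_const a * mpol_const b"
  by (simp_all add: mpol_const_def single_add mult_single)

lemma sym_act_simps [simp]: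
  fixes f g :: "(nat \<times> 'n, 'k::comm_ring_1) mpol"
  shows "sym_act \<sigma> (0 :: (nat \<times> 'n, 'k) mpol) = 0"
  "sym_act \<sigma> (1 :: (nat \<times> 'n, 'k) mpol) = 1"
  "sym_act \<sigma> (f + g) = sym_act \<sigma> f + sym_act \<sigma> g"
  "sym_act \<sigma> (f * g) = sym_act \<sigma> f * sym_act \<sigma> g"
  "sym_act \<sigma> (mpol_const a :: (nat \<times> 'n, 'k) mpol) = mpol_const a"
  "sym_act \<sigma> (mpol_var (i, j) :: (nat \<times> 'n, 'k) mpol) = mpol_var (\<sigma> i, j)"
  unfolding sym_act_def
proof -
  let ?c = "mpol_const :: 'k \<Rightarrow> (nat \<times> 'n, 'k) mpol"
    and ?x = "\<lambda>(i, j). mpol_var (\<sigma> i, j) :: (nat \<times> 'n, 'k) mpol"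
  show "mpol_hom ?c ?x 0 = 0" by (rule mpol_hom_zero[of ?c, OF mpol_const_hom])
  show "mpol_hom ?c ?x 1 = 1" by (rule mpol_hom_one[of ?c, OF mpol_const_hom])
  show "mpol_hom ?c ?x (f + g) = mpol_hom ?c ?x f + mpol_hom ?c ?x g"
    by (rule mpol_hom_add[of ?c, OF mpol_const_hom])
  show "mpol_hom ?c ?x (f * g) = mpol_hom ?c ?x f * mpol_hom ?c ?x g"
    by (rule mpol_hom_mult[of ?c, OF mpol_const_hom])
  show "mpol_hom ?c ?x (mpol_const a) = mpol_const a"
    by (rule mpol_hom_const[of ?c, OF mpol_const_hom])
  show "mpol_hom ?c ?x (mpol_var (i, j)) = mpol_var (\<sigma> i, j)"
    by (subst mpol_hom_var[of ?c, OF mpol_const_hom]) simp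
qed

end

theory Submission
  imports Defs "HOL-Combinatorics.Permutations"
begin

text \<open>
  A rational point lies in an orbit closure iff every polynomial vanishing on the orbit vanishes
  there.

  If \<open>v\<^sub>j\<close> occurs \<open>m\<close> times in \<open>p\<close>, choose \<open>h\<close> vanishing on the other components but not at \<open>v\<^sub>j\<close>. For
  distinct \<open>i\<^sub>0, \<dots>, i\<^sub>m\<close> the product of the \<open>h\<close> evaluated at the \<open>i\<^sub>l\<close>-th points vanishes on the orbit,
  so \<open>v\<^sub>j\<close> cannot occur more than \<open>m\<close> times in a point of the closure.

  Conversely, a polynomial \<open>f\<close> vanishing on the orbit involves finitely many positions and vanishes
  whenever these are filled with entries of \<open>p\<close> having distinct indices. Fill the positions where
  \<open>w\<close> is isolated with the corresponding entries of \<open>p\<close>. The other positions are switched from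
  entries of \<open>p\<close> to entries of \<open>w\<close> one at a time: an irreducible set with infinitely many rational
  points contained in the closure of all \<open>p\<^sub>i\<close> remains in the closure after finitely many
  indices are discarded.
\<close>

section \<open>Homomorphisms out of polynomial rings\<close>

context
  fixes c :: "'k::comm_ring_1 \<Rightarrow> 'b::comm_ring_1"
  assumes c: "c 0 = 0" "c 1 = 1" "\<And>a b. c (a + b) = c a + c b" "\<And>a b. c (a * b) = c a * c b"
begin

lemma mpol_hom_sum: "mpol_hom c x (sum g A) = (\<Sum>i\<in>A. mpol_hom c x (g i))"
  by (induction A rule: infinite_finite_induct)
    (simp_all add: mpol_hom_zero[of c, OF c] mpol_hom_add[of c, OF c])

lemma mpol_hom_prod: "mpol_hom c x (prod g A) = (\<Prod>i\<in>A. mpol_hom c x (g i))"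
  by (induction A rule: infinite_finite_induct)
    (simp_all add: mpol_hom_one[of c, OF c] mpol_hom_mult[of c, OF c])

lemma mpol_hom_power: "mpol_hom c x (f ^ n) = mpol_hom c x f ^ n"
  by (induction n) (simp_all add: mpol_hom_one[of c, OF c] mpol_hom_mult[of c, OF c])

text \<open>\<open>mpol_hom c y\<close> is a ring homomorphism sending \<open>mpol_const a\<close>
  to \<open>c a\<close>, so it passes through the sum, products and powers of the inner
  substitution. Evaluation and the group action are both substitutions, so this rule serves
  both.\<close>

lemma mpol_hom_compose:
  "mpol_hom c y (mpol_hom mpol_const g f) = mpol_hom c (\<lambda>v. mpol_hom c y (g v)) f"
  unfolding mpol_hom_def[of mpol_const] mpol_hom_def[of c _ f]
  by (simp add: mpol_hom_sum mpol_hom_prod mpol_hom_power mpol_hom_mult[of c, OF c]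
      mpol_hom_const[of c, OF c])

end

lemma mpol_eval_compose:
  "mpol_eval y (mpol_hom mpol_const g f) = mpol_eval (\<lambda>v. mpol_eval y (g v)) f"
  unfolding mpol_eval_def by (rule mpol_hom_compose) simp_all

lemma mpol_eval_prod: "mpol_eval x (prod g A) = (\<Prod>i\<in>A. mpol_eval x (g i))"
  unfolding mpol_eval_def by (rule mpol_hom_prod) simp_all

lemma mpol_var_power:
  "(mpol_var v :: ('v, 'k::comm_ring_1) mpol) ^ n = Poly_Mapping.single (Poly_Mapping.single v n) 1"
  by (induction n) (simp_all add: mpol_var_def mult_single single_add[symmetric])

lemma prod_single_one:
  "(\<Prod>i\<in>A. Poly_Mapping.single (g i) (1::'k::comm_ring_1)) = Poly_Mapping.single (\<Sum>i\<in>A. g i) 1"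
  by (induction A rule: infinite_finite_induct) (simp_all add: mult_single)

lemma sum_single_lookup:
  "(\<Sum>v\<in>Poly_Mapping.keys m. Poly_Mapping.single v (Poly_Mapping.lookup m v)) = m"
  by (rule poly_mapping_eqI)
    (auto simp: lookup_sum lookup_single when_def in_keys_iff)

text \<open>Needed to see that the actions of mutually inverse permutations cancel.\<close>

lemma mpol_hom_const_var: "mpol_hom mpol_const mpol_var f = (f :: ('v, 'k::comm_ring_1) mpol)"
proof (induction f rule: mpol_induct)
  case zero
  show ?case by (rule mpol_hom_zero[of mpol_const, OF mpol_const_hom])
next
  case (add_single f m a)
  have "mpol_hom mpol_const mpol_var (Poly_Mapping.single m a) = Poly_Mapping.single m a"
    by (simp add: mpol_hom_single[of mpol_const, OF mpol_const_hom] mpol_var_power prod_single_one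
        sum_single_lookup mpol_const_def mult_single)
  with add_single show ?case
    by (simp add: mpol_hom_add[of mpol_const, OF mpol_const_hom])
qed

lemma mpol_eval_cong_finite:
  fixes f :: "('v, 'k::comm_ring_1) mpol"
  obtains N where "finite N" "\<And>x y. (\<And>v. v \<in> N \<Longrightarrow> x v = y v) \<Longrightarrow> mpol_eval x f = mpol_eval y f"
proof
  let ?N = "\<Union>m\<in>Poly_Mapping.keys f. Poly_Mapping.keys m"
  show "finite ?N" by simp
  show "mpol_eval x f = mpol_eval y f" if eq: "\<And>v. v \<in> ?N \<Longrightarrow> x v = y v" for x y :: "'v \<Rightarrow> 'k"
    unfolding mpol_eval_def mpol_hom_def
    by (intro sum.cong prod.cong arg_cong2[where f = "(*)"] arg_cong2[where f = "(^)"] refl eq) auto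
qed

section \<open>Rational points and Zariski closures\<close>

text \<open>The linear polynomial \<open>mpol_var v\<close> minus the constant \<open>x v\<close>
  pins down each coordinate. Consequently the closure of one rational point contains no other
  rational point.\<close>

lemma kpoint_subsetD:
  fixes x y :: "'v \<Rightarrow> 'k::comm_ring_1"
  assumes "kpoint x \<subseteq> kpoint y"
  shows "x = y"
proof
  fix v
  have "mpol_var v + mpol_const (- x v) \<in> kpoint x" by (simp add: kpoint_def)
  with assms have "mpol_var v + mpol_const (- x v) \<in> kpoint y" by blast
  then show "x v = y v" by (simp add: kpoint_def)
qed

lemma kpoint_eq_iff: "kpoint x = kpoint y \<longleftrightarrow> x = y"
  using kpoint_subsetD[of x y] by auto

text \<open>The zero locus of \<open>\<Inter>S\<close> is closed, and the equations \<open>E\<close>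
  of any closed set containing \<open>S\<close> lie in \<open>\<Inter>S\<close>.\<close>

lemma in_closure_zariski_iff:
  assumes "S \<subseteq> Spec"
  shows "P \<in> zariski closure_of S \<longleftrightarrow> P \<in> Spec \<and> \<Inter>S \<subseteq> P"
proof -
  have "zariski closure_of S = {P \<in> Spec. \<Inter>S \<subseteq> P}"
  proof (rule closure_of_unique)
    show "S \<subseteq> {P \<in> Spec. \<Inter>S \<subseteq> P}" using assms by blast
    show "closedin zariski {P \<in> Spec. \<Inter>S \<subseteq> P}" unfolding closedin_zariski by blast
    show "{P \<in> Spec. \<Inter>S \<subseteq> P} \<subseteq> T" if T: "S \<subseteq> T" "closedin zariski T" for T
    proof -
      obtain E where "T = {P \<in> Spec. E \<subseteq> P}" using T(2) unfolding closedin_zariski by blast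
      with T(1) show ?thesis by blast
    qed
  qed
  then show ?thesis by simp
qed

lemma kpoint_in_closure_iff:
  fixes q :: "'i \<Rightarrow> 'v \<Rightarrow> 'k::field"
  shows "kpoint x \<in> zariski closure_of ((\<lambda>i. kpoint (q i)) ` I) \<longleftrightarrow>
    (\<forall>f. (\<forall>i\<in>I. mpol_eval (q i) f = 0) \<longrightarrow> mpol_eval x f = 0)"
proof -
  have "(\<lambda>i. kpoint (q i)) ` I \<subseteq> Spec" by (auto simp: kpoint_in_Spec)
  then show ?thesis
    by (simp add: in_closure_zariski_iff kpoint_in_Spec) (auto simp: kpoint_def)
qed

text \<open>Splitting the points into those over \<open>F\<close> and the rest, irreducibility puts
  \<open>S\<close> into one of the two closures. The one over \<open>F\<close> has only finitely
  many rational points.\<close>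

lemma irreducible_in_cofinite_closure:
  fixes q :: "'i \<Rightarrow> 'v \<Rightarrow> 'k::field"
  assumes "irreducible_in zariski S" "S \<subseteq> zariski closure_of range (\<lambda>i. kpoint (q i))"
    and "infinite (kpoints S)" "finite F"
  shows "S \<subseteq> zariski closure_of ((\<lambda>i. kpoint (q i)) ` (- F))"
proof (rule ccontr)
  let ?k = "\<lambda>i. kpoint (q i)"
  assume "\<not> ?thesis"
  moreover have "range ?k = ?k ` F \<union> ?k ` (- F)" by blast
  ultimately have "S \<subseteq> zariski closure_of (?k ` F)"
    using assms(1,2) unfolding irreducible_in_def
    by (metis closure_of_Un closedin_closure_of)
  also have "zariski closure_of (?k ` F) = (\<Union>i\<in>F. zariski closure_of {?k i})"
    using closure_of_Union[of "(\<lambda>i. {?k i}) ` F" zariski] assms(4)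
    by (simp add: UNION_singleton_eq_range)
  finally have "kpoints S \<subseteq> q ` F"
    by (auto simp: kpoints_def in_closure_zariski_iff kpoint_in_Spec dest!: subsetD kpoint_subsetD)
  with assms(3,4) show False using finite_surj by blast
qed

section \<open>Irreducible components\<close>

text \<open>A set and its closure lie in the same closed sets, and irreducibility only tests
  containment in closed sets.\<close>

lemma irreducible_in_closure_of:
  assumes "irreducible_in T S"
  shows "irreducible_in T (T closure_of S)"
proof -
  have "S \<subseteq> T closure_of S" using assms closure_of_subset unfolding irreducible_in_def by auto
  moreover have "T closure_of S \<subseteq> A \<longleftrightarrow> S \<subseteq> A" if "closedin T A" for A
    using closure_of_minimal[OF _ that] \<open>S \<subseteq> T closure_of S\<close> by blast
  ultimately show ?thesis
    using assms closure_of_subset_topspace[of T S] unfolding irreducible_in_def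
    by (metis closedin_Un subset_empty)
qed

lemma closedin_irreducible_component:
  assumes "closedin T Y" "S \<in> irreducible_components T Y"
  shows "closedin T S"
proof -
  have S: "S \<subseteq> Y" "irreducible_in T S"
    and max: "\<And>S'. S \<subseteq> S' \<Longrightarrow> S' \<subseteq> Y \<Longrightarrow> irreducible_in T S' \<Longrightarrow> S' = S"
    using assms(2) unfolding irreducible_components_def by blast+
  have "T closure_of S = S"
    using S assms(1) irreducible_in_closure_of[OF S(2)]
    by (intro max closure_of_subset closure_of_minimal) (auto simp: irreducible_in_def)
  then show ?thesis by (metis closedin_closure_of)
qed

text \<open>Provides the upper bounds for Zorn's lemma.\<close>

lemma irreducible_in_Union_chain:
  assumes "subset.chain {S. irreducible_in T S} \<C>" "\<C> \<noteq> {}"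
  shows "irreducible_in T (\<Union>\<C>)"
  unfolding irreducible_in_def
proof (intro conjI allI impI)
  have irr: "irreducible_in T S" if "S \<in> \<C>" for S
    using assms(1) that unfolding subset_chain_def by blast
  show "\<Union>\<C> \<subseteq> topspace T" using irr unfolding irreducible_in_def by blast
  show "\<Union>\<C> \<noteq> {}" using irr assms(2) unfolding irreducible_in_def by blast
  fix A B assume AB: "closedin T A" "closedin T B" "\<Union>\<C> \<subseteq> A \<union> B"
  show "\<Union>\<C> \<subseteq> A \<or> \<Union>\<C> \<subseteq> B"
  proof (rule ccontr)
    assume "\<not> ?thesis"
    then obtain S1 S2 where S12: "S1 \<in> \<C>" "S2 \<in> \<C>" "\<not> S1 \<subseteq> A" "\<not> S2 \<subseteq> B" by blast
    then have "S1 \<subseteq> S2 \<or> S2 \<subseteq> S1" using assms(1) by (simp add: subset_chain_def)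
    \<comment> \<open>The larger of \<open>S1\<close> and \<open>S2\<close> escapes both
      \<open>A\<close> and \<open>B\<close>.\<close>
    with S12 obtain S where S: "S \<in> \<C>" "\<not> S \<subseteq> A" "\<not> S \<subseteq> B" by blast
    then have "S \<subseteq> A \<union> B" using AB(3) by blast
    with irr[OF S(1)] AB(1,2) S(2,3) show False unfolding irreducible_in_def by blast
  qed
qed

text \<open>Zorn's lemma for the irreducible subsets of \<open>Y\<close> containing a given point;
  the singleton is one of them. A maximal member is a component, since every larger set still
  contains the point.\<close>

lemma Union_irreducible_components:
  assumes "Y \<subseteq> topspace T"
  shows "\<Union>(irreducible_components T Y) = Y"
proof
  show "\<Union>(irreducible_components T Y) \<subseteq> Y" unfolding irreducible_components_def by blast
  show "Y \<subseteq> \<Union>(irreducible_components T Y)"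
  proof
    fix x assume x: "x \<in> Y"
    let ?A = "{S. x \<in> S \<and> S \<subseteq> Y \<and> irreducible_in T S}"
    have "\<exists>M\<in>?A. \<forall>S\<in>?A. M \<subseteq> S \<longrightarrow> S = M"
    proof (rule subset_Zorn_nonempty)
      have "{x} \<in> ?A" using x assms unfolding irreducible_in_def by auto
      then show "?A \<noteq> {}" by blast
      fix \<C> assume "\<C> \<noteq> {}" and chain: "subset.chain ?A \<C>"
      then have sub: "\<C> \<subseteq> ?A" unfolding subset_chain_def by simp
      with chain have "subset.chain {S. irreducible_in T S} \<C>"
        unfolding subset_chain_def by blast
      then have "irreducible_in T (\<Union>\<C>)"
        using \<open>\<C> \<noteq> {}\<close> by (rule irreducible_in_Union_chain)
      with sub \<open>\<C> \<noteq> {}\<close> show "\<Union>\<C> \<in> ?A" by blast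
    qed
    then obtain M where M: "M \<in> ?A" and max: "\<forall>S\<in>?A. M \<subseteq> S \<longrightarrow> S = M" by (rule bexE)
    have "S = M" if "M \<subseteq> S" "S \<subseteq> Y" "irreducible_in T S" for S
      using M max that by blast
    with M have "M \<in> irreducible_components T Y" unfolding irreducible_components_def by blast
    with M show "x \<in> \<Union>(irreducible_components T Y)" by blast
  qed
qed

section \<open>Orbits of rational points\<close>

lemma mpol_eval_sym_act:
  "mpol_eval (case_prod y) (sym_act \<sigma> f) = mpol_eval (\<lambda>(i, j). y (\<sigma> i) j) f"
  unfolding sym_act_def mpol_eval_compose by (simp add: case_prod_unfold)

lemma sym_act_inverse:
  fixes f :: "(nat \<times> 'n, 'k::comm_ring_1) mpol"
  assumes "\<And>i. \<sigma> (\<tau> i) = i"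
  shows "sym_act \<sigma> (sym_act \<tau> f) = f"
proof -
  have "sym_act \<sigma> (sym_act \<tau> f) =
    mpol_hom mpol_const (\<lambda>v. sym_act \<sigma> (case v of (i, j) \<Rightarrow> mpol_var (\<tau> i, j))) f"
    unfolding sym_act_def by (rule mpol_hom_compose[of mpol_const, OF mpol_const_hom])
  also have "(\<lambda>v. sym_act \<sigma> (case v of (i, j) \<Rightarrow> mpol_var (\<tau> i, j))) =
      (mpol_var :: _ \<Rightarrow> (nat \<times> 'n, 'k) mpol)"
    by (auto simp: assms)
  finally show ?thesis by (simp add: mpol_hom_const_var)
qed

lemma Sym_infE:
  assumes "\<sigma> \<in> Sym_inf"
  obtains "inv_into UNIV \<sigma> \<in> Sym_inf" "\<And>i. \<sigma> (inv_into UNIV \<sigma> i) = i"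
    "\<And>i. inv_into UNIV \<sigma> (\<sigma> i) = i" "inv_into UNIV (inv_into UNIV \<sigma>) = \<sigma>"
proof -
  obtain k where k: "\<sigma> permutes {..<k}" using assms unfolding Sym_inf_def by blast
  then have "inv_into UNIV \<sigma> \<in> Sym_inf" unfolding Sym_inf_def using permutes_inv by blast
  with k that show ?thesis by (metis permutes_inverses permutes_inv_inv)
qed

text \<open>Evaluating \<open>sym_act \<sigma> f\<close> reindexes the sequence by
  \<open>\<sigma>\<close>, so on points the action is by the inverse.\<close>

lemma sym_act_kpoint:
  assumes "\<sigma> \<in> Sym_inf"
  shows "sym_act \<sigma> ` kpoint (case_prod q) = kpoint (\<lambda>(i, j). q (inv_into UNIV \<sigma> i) j)"
proof (rule Sym_infE[OF assms], intro equalityI subsetI)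
  fix f
  assume inv: "\<And>i. \<sigma> (inv_into UNIV \<sigma> i) = i" "\<And>i. inv_into UNIV \<sigma> (\<sigma> i) = i"
  {
    assume "f \<in> sym_act \<sigma> ` kpoint (case_prod q)"
    then show "f \<in> kpoint (\<lambda>(i, j). q (inv_into UNIV \<sigma> i) j)"
      by (auto simp: kpoint_def mpol_eval_sym_act inv)
  next
    assume "f \<in> kpoint (\<lambda>(i, j). q (inv_into UNIV \<sigma> i) j)"
    then have "sym_act (inv_into UNIV \<sigma>) f \<in> kpoint (case_prod q)"
      by (simp add: kpoint_def mpol_eval_sym_act)
    moreover have "f = sym_act \<sigma> (sym_act (inv_into UNIV \<sigma>) f)" by (simp add: sym_act_inverse inv)
    ultimately show "f \<in> sym_act \<sigma> ` kpoint (case_prod q)" by blast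
  }
qed

text \<open>\<open>Sym_inf\<close> is closed under inversion, so the inverses can be reindexed
  away.\<close>

lemma sym_orbit_kpoint:
  "sym_orbit (kpoint (case_prod q)) = (\<lambda>\<tau>. kpoint (\<lambda>(i, j). q (\<tau> i) j)) ` Sym_inf"
proof -
  have inv_Sym: "Sym_inf = inv_into UNIV ` Sym_inf"
  proof (intro equalityI subsetI)
    show "\<sigma> \<in> inv_into UNIV ` Sym_inf" if "\<sigma> \<in> Sym_inf" for \<sigma> :: "nat \<Rightarrow> nat"
      using that by (rule Sym_infE) (metis image_eqI)
  qed (auto elim: Sym_infE)
  have "(\<lambda>\<tau>. kpoint (\<lambda>(i, j). q (\<tau> i) j)) ` Sym_inf =
      (\<lambda>\<sigma>. kpoint (\<lambda>(i, j). q (inv_into UNIV \<sigma> i) j)) ` Sym_inf"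
    by (subst inv_Sym) (simp only: image_image)
  also have "\<dots> = (\<lambda>\<sigma>. sym_act \<sigma> ` kpoint (case_prod q)) ` Sym_inf"
    by (intro image_cong refl sym_act_kpoint[symmetric])
  finally show ?thesis unfolding sym_orbit_def by (simp only: Setcompr_eq_image)
qed

lemma mem_kpoints_orbit_closure_iff:
  fixes q :: "nat \<Rightarrow> 'n \<Rightarrow> 'k::field"
  shows "x \<in> kpoints (orbit_closure (kpoint (case_prod q))) \<longleftrightarrow>
    (\<forall>f. (\<forall>\<tau>\<in>Sym_inf. mpol_eval (\<lambda>(i, j). q (\<tau> i) j) f = 0) \<longrightarrow> mpol_eval x f = 0)"
  unfolding kpoints_def orbit_closure_def sym_orbit_kpoint by (simp add: kpoint_in_closure_iff)

text \<open>Inside a large \<open>{..<k}\<close> the complements of \<open>N\<close> and of its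
  image have equal size, and a bijection between them completes \<open>\<sigma>\<close> to a
  permutation.\<close>

lemma inj_on_extends_Sym_inf:
  fixes \<sigma> :: "nat \<Rightarrow> nat"
  assumes "finite N" "inj_on \<sigma> N"
  obtains \<tau> where "\<tau> \<in> Sym_inf" "\<And>i. i \<in> N \<Longrightarrow> \<tau> i = \<sigma> i"
proof -
  obtain k where k: "N \<union> \<sigma> ` N \<subseteq> {..<k}"
    using finite_nat_bounded[of "N \<union> \<sigma> ` N"] assms(1) by auto
  have "card ({..<k} - N) = card ({..<k} - \<sigma> ` N)"
    using k assms by (simp add: card_Diff_subset card_image)
  then obtain g where g: "bij_betw g ({..<k} - N) ({..<k} - \<sigma> ` N)"
    using finite_same_card_bij[of "{..<k} - N" "{..<k} - \<sigma> ` N"] by auto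
  define \<tau> where "\<tau> i = (if i \<in> N then \<sigma> i else if i < k then g i else i)" for i
  have "bij_betw \<tau> N (\<sigma> ` N)"
    using assms(2) by (simp add: bij_betw_def inj_on_def \<tau>_def image_def)
  moreover have "bij_betw \<tau> ({..<k} - N) ({..<k} - \<sigma> ` N)"
    using g by (rule bij_betw_cong[THEN iffD1, rotated]) (simp add: \<tau>_def)
  ultimately have "bij_betw \<tau> (N \<union> ({..<k} - N)) (\<sigma> ` N \<union> ({..<k} - \<sigma> ` N))"
    by (rule bij_betw_combine) blast
  moreover have "N \<union> ({..<k} - N) = {..<k}" "\<sigma> ` N \<union> ({..<k} - \<sigma> ` N) = {..<k}"
    using k by blast+
  ultimately have "\<tau> permutes {..<k}"
    using k by (intro bij_imp_permutes) (auto simp: \<tau>_def)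
  with that[of \<tau>] show ?thesis unfolding Sym_inf_def \<tau>_def by auto
qed

section \<open>Rational points of orbit closures\<close>

text \<open>An equation of all the \<open>q k\<close>, rewritten in the variables of the
  \<open>i\<close>-th point, vanishes on the orbit.\<close>

lemma orbit_closure_imp_closure:
  fixes q :: "nat \<Rightarrow> 'n \<Rightarrow> 'k::field"
  assumes "case_prod w \<in> kpoints (orbit_closure (kpoint (case_prod q)))"
  shows "w i \<in> kpoints (zariski closure_of range (\<lambda>i. kpoint (q i)))"
  unfolding kpoints_def mem_Collect_eq kpoint_in_closure_iff
proof (intro allI impI)
  fix f :: "('n, 'k) mpol"
  assume "\<forall>i\<in>UNIV. mpol_eval (q i) f = 0"
  then have "mpol_eval (case_prod w) (mpol_hom mpol_const (\<lambda>j. mpol_var (i, j)) f) = 0"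
    by (intro assms[unfolded mem_kpoints_orbit_closure_iff, rule_format])
      (simp add: mpol_eval_compose)
  then show "mpol_eval (w i) f = 0" by (simp add: mpol_eval_compose)
qed

text \<open>In the application \<open>C\<close> is the union of the components other than the
  isolated point \<open>P\<close>.\<close>

lemma orbit_closure_isolated_lepoll:
  fixes q :: "nat \<Rightarrow> 'n \<Rightarrow> 'k::field"
  assumes w: "case_prod w \<in> kpoints (orbit_closure (kpoint (case_prod q)))"
    and C: "closedin zariski C" "P \<in> Spec" "P \<notin> C" "\<And>i. kpoint (q i) \<in> insert P C"
  shows "{i. kpoint (w i) = P} \<lesssim> {i. kpoint (q i) = P}"
proof (cases "finite {i. kpoint (q i) = P}")
  case False
  then show ?thesis
    by (meson infinite_le_lepoll lepoll_trans subset_UNIV subset_imp_lepoll)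
next
  case True
  let ?W = "{i. kpoint (w i) = P}" and ?Q = "{i. kpoint (q i) = P}"
  show ?thesis
  proof (rule ccontr)
    assume less: "\<not> ?thesis"
    \<comment> \<open>\<open>?W\<close> may be infinite, but the product \<open>?f\<close> needs a
      finite index set, so a finite subset with more than \<open>card ?Q\<close> elements is
      taken.\<close>
    obtain A where A: "A \<subseteq> ?W" "finite A" "card ?Q < card A"
    proof (cases "finite ?W")
      case True
      with less \<open>finite ?Q\<close> have "card ?Q < card ?W" by (simp add: lepoll_iff_card_le)
      with True that[of ?W] show ?thesis by blast
    next
      case False
      then obtain A where "A \<subseteq> ?W" "finite A" "card A = Suc (card ?Q)"
        using infinite_arbitrarily_large[OF False, of "Suc (card ?Q)"] by blast
      with that[of A] show ?thesis by simp
    qed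
    obtain E where E: "C = {P \<in> Spec. E \<subseteq> P}" using C(1) unfolding closedin_zariski by blast
    with C(2,3) have "\<not> E \<subseteq> P" by simp
    then obtain h where h: "h \<in> E" "h \<notin> P" by blast
    let ?f = "\<Prod>i\<in>A. mpol_hom mpol_const (\<lambda>j. mpol_var (i, j)) h"
    have eval_f: "mpol_eval (case_prod y) ?f = (\<Prod>i\<in>A. mpol_eval (y i) h)" for y
      by (simp add: mpol_eval_prod mpol_eval_compose)
    have "mpol_eval (case_prod w) ?f = 0"
    proof (rule w[unfolded mem_kpoints_orbit_closure_iff, rule_format])
      fix \<tau> :: "nat \<Rightarrow> nat"
      assume "\<tau> \<in> Sym_inf"
      then have "inj \<tau>" by (rule Sym_infE) (metis injI)
      then have "card (\<tau> ` A) = card A" by (rule card_image[OF inj_on_subset]) simp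
      \<comment> \<open>Pigeonhole: some factor of \<open>?f\<close> is evaluated at a point of
        \<open>C\<close>, where \<open>h\<close> vanishes.\<close>
      then have "\<not> \<tau> ` A \<subseteq> ?Q"
        using card_mono[OF \<open>finite ?Q\<close>, of "\<tau> ` A"] A(3) by linarith
      then obtain i where "i \<in> A" "kpoint (q (\<tau> i)) \<noteq> P" by blast
      with C(4)[of "\<tau> i"] have "kpoint (q (\<tau> i)) \<in> C" by simp
      with h(1) have "mpol_eval (q (\<tau> i)) h = 0" by (auto simp: E kpoint_def)
      with \<open>i \<in> A\<close> A(2) have "(\<Prod>i\<in>A. mpol_eval (q (\<tau> i)) h) = 0" by auto
      then show "mpol_eval (\<lambda>(i, j). q (\<tau> i) j) ?f = 0"
        using eval_f[of "\<lambda>i. q (\<tau> i)"] by simp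
    qed
    then obtain i where "i \<in> A" "mpol_eval (w i) h = 0" using A(2) by (auto simp: eval_f)
    with A(1) h(2) show False by (auto simp: kpoint_def)
  qed
qed

text \<open>\<open>\<P>\<close> collects the isolated points, whose entries must be matched exactly;
  all other entries of \<open>w\<close> need only be approximated by cofinitely many entries of
  \<open>q\<close>.\<close>

lemma orbit_closureI:
  fixes q :: "nat \<Rightarrow> 'n \<Rightarrow> 'k::field"
  assumes lepoll: "\<And>P. P \<in> \<P> \<Longrightarrow> {i. kpoint (w i) = P} \<lesssim> {i. kpoint (q i) = P}"
    and dense: "\<And>i F. finite F \<Longrightarrow> kpoint (w i) \<notin> \<P> \<Longrightarrow>
      kpoint (w i) \<in> zariski closure_of ((\<lambda>k. kpoint (q k)) ` (- F))"
  shows "case_prod w \<in> kpoints (orbit_closure (kpoint (case_prod q)))"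
  unfolding mem_kpoints_orbit_closure_iff
proof (intro allI impI)
  fix f :: "(nat \<times> 'n, 'k) mpol"
  assume f: "\<forall>\<tau>\<in>Sym_inf. mpol_eval (\<lambda>(i, j). q (\<tau> i) j) f = 0"
  obtain N' where N': "finite N'"
    "\<And>x y. (\<And>v. v \<in> N' \<Longrightarrow> x v = y v) \<Longrightarrow> mpol_eval x f = mpol_eval y f"
    using mpol_eval_cong_finite[of f] by blast
  define N where "N = fst ` N'"
  have fin_N: "finite N" using N'(1) unfolding N_def by simp
  have eval_N: "mpol_eval (case_prod x) f = mpol_eval (case_prod y) f"
    if "\<And>i. i \<in> N \<Longrightarrow> x i = y i" for x y
  proof (rule N'(2))
    show "case_prod x v = case_prod y v" if "v \<in> N'" for v
      using that \<open>\<And>i. i \<in> N \<Longrightarrow> x i = y i\<close>[of "fst v"]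
      unfolding N_def by (simp add: case_prod_unfold)
  qed
  define D where "D = {i \<in> N. kpoint (w i) \<in> \<P>}"
  have "\<forall>P\<in>\<P>. \<exists>g. inj_on g {i. kpoint (w i) = P} \<and>
      g ` {i. kpoint (w i) = P} \<subseteq> {i. kpoint (q i) = P}"
    using lepoll unfolding lepoll_def by blast
  then obtain g where g: "\<And>P. P \<in> \<P> \<Longrightarrow> inj_on (g P) {i. kpoint (w i) = P}"
    "\<And>P. P \<in> \<P> \<Longrightarrow> g P ` {i. kpoint (w i) = P} \<subseteq> {i. kpoint (q i) = P}"
    by metis
  \<comment> \<open>Gluing the injections \<open>g P\<close> stays injective, because distinct
    points \<open>P\<close> have disjoint fibres in \<open>q\<close>.\<close>
  define \<rho> where "\<rho> i = g (kpoint (w i)) i" for i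
  have q_\<rho>: "kpoint (q (\<rho> i)) = kpoint (w i)" if "i \<in> D" for i
    using g(2)[of "kpoint (w i)"] that unfolding D_def \<rho>_def by blast
  have inj_\<rho>: "inj_on \<rho> D"
  proof (rule inj_onI)
    fix i i' assume ii: "i \<in> D" "i' \<in> D" "\<rho> i = \<rho> i'"
    then have "kpoint (w i) = kpoint (w i')" using q_\<rho> by metis
    with ii g(1)[of "kpoint (w i)"] show "i = i'" unfolding D_def \<rho>_def inj_on_def by auto
  qed
  \<comment> \<open>\<open>T\<close> is the set of positions already switched to \<open>w\<close>.
    \<open>\<sigma>\<close> is prescribed only on \<open>D\<close> and stays general elsewhere,
    because the induction step redirects it at the new position.\<close>
  have "mpol_eval (case_prod (\<lambda>i. if i \<in> T then w i else q (\<sigma> i))) f = 0"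
    if "finite T" "T \<subseteq> N - D" "inj_on \<sigma> (N - T)" "\<And>i. i \<in> D \<Longrightarrow> \<sigma> i = \<rho> i" for T \<sigma>
    using that
  proof (induction T arbitrary: \<sigma> rule: finite_induct)
    case empty
    then obtain \<tau> where \<tau>: "\<tau> \<in> Sym_inf" "\<And>i. i \<in> N \<Longrightarrow> \<tau> i = \<sigma> i"
      using inj_on_extends_Sym_inf[of N \<sigma>] fin_N by auto
    have "mpol_eval (case_prod (\<lambda>i. q (\<sigma> i))) f = mpol_eval (case_prod (\<lambda>i. q (\<tau> i))) f"
      using \<tau>(2) by (intro eval_N) simp
    with f \<tau>(1) show ?case by simp
  next
    case (insert t T)
    let ?F = "\<sigma> ` (N - insert t T)"
    let ?z = "\<lambda>y i. if i = t then y else if i \<in> T then w i else q (\<sigma> i)"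
    \<comment> \<open>\<open>f\<close> as a polynomial in the point at position \<open>t\<close>
      alone, all other points being frozen. \<open>undefined\<close> stands only in the slot
      \<open>t\<close>, which this branch never reads.\<close>
    let ?f = "mpol_hom mpol_const
      (\<lambda>(i, j). if i = t then mpol_var j else mpol_const (?z undefined i j)) f"
    have eval_f: "mpol_eval y ?f = mpol_eval (case_prod (?z y)) f" for y
      unfolding mpol_eval_compose by (rule arg_cong[where f = "\<lambda>x. mpol_eval x f"]) auto
    \<comment> \<open>\<open>?F\<close> holds the indices used at the other unswitched positions;
      avoiding it keeps \<open>\<sigma>(t := k)\<close> injective, so the induction hypothesis
      applies.\<close>
    have "mpol_eval (q k) ?f = 0" if "k \<notin> ?F" for k
    proof -
      have eq: "?z (q k) = (\<lambda>i. if i \<in> T then w i else q ((\<sigma>(t := k)) i))"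
        using insert.hyps(2) by auto
      have "N - T = insert t (N - insert t T)" using insert by blast
      then have inj: "inj_on (\<sigma>(t := k)) (N - T)"
        using insert.prems(2) that by (auto simp: inj_on_def)
      have "T \<subseteq> N - D" "\<And>i. i \<in> D \<Longrightarrow> (\<sigma>(t := k)) i = \<rho> i"
        using insert.prems(1,3) by auto
      with inj show ?thesis unfolding eval_f eq by (intro insert.IH)
    qed
    moreover have "kpoint (w t) \<notin> \<P>" using insert.prems(1) unfolding D_def by blast
    then have "kpoint (w t) \<in> zariski closure_of ((\<lambda>k. kpoint (q k)) ` (- ?F))"
      using fin_N by (intro dense) auto
    ultimately have "mpol_eval (w t) ?f = 0" unfolding kpoint_in_closure_iff by blast
    moreover have "?z (w t) = (\<lambda>i. if i \<in> insert t T then w i else q (\<sigma> i))" by auto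
    ultimately show ?case unfolding eval_f by simp
  qed
  \<comment> \<open>With all of \<open>N - D\<close> switched, injectivity is required only on
    \<open>D\<close>, where \<open>\<rho>\<close> has it.\<close>
  from this[of "N - D" \<rho>] have "mpol_eval (case_prod (\<lambda>i. if i \<in> N - D then w i else q (\<rho> i))) f = 0"
    using fin_N inj_\<rho> by (simp add: double_diff D_def)
  moreover have "mpol_eval (case_prod (\<lambda>i. if i \<in> N - D then w i else q (\<rho> i))) f =
      mpol_eval (case_prod w) f"
    using q_\<rho> by (intro eval_N) (auto simp: kpoint_eq_iff)
  ultimately show "mpol_eval (case_prod w) f = 0" by simp
qed

theorem theorem3p5:
  fixes p :: "nat \<Rightarrow> 'n::finite \<Rightarrow> 'k::alg_closed_field"
    and V :: "nat \<Rightarrow> ('n, 'k) mpol set set"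
    and v :: "nat \<Rightarrow> ('n, 'k) mpol set"
    and r s :: nat
    and Vp :: "('n, 'k) mpol set set"
    and Y :: "(nat \<times> 'n, 'k) mpol set set"
  assumes "uncountable (UNIV :: 'k set)"
    and "Vp = zariski closure_of {kpoint (p i) | i. True}"
    and "irreducible_components zariski Vp = V ` {1..r} \<union> (\<lambda>j. {v j}) ` {1..s}"
    and "inj_on V {1..r}" and "inj_on v {1..s}"
    and "\<And>i. i \<in> {1..r} \<Longrightarrow> infinite (kpoints (V i))"
    and "\<And>j. j \<in> {1..s} \<Longrightarrow> closedin zariski {v j}"
    and "Y = orbit_closure (kpoint (case_prod p))"
  shows "{w. case_prod w \<in> kpoints Y} =
    {w. (\<forall>i. w i \<in> kpoints Vp) \<and>
        (\<forall>j\<in>{1..s}. {i. kpoint (w i) = v j} \<lesssim> {i. kpoint (p i) = v j})}"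
proof -
  have Vp: "Vp = zariski closure_of range (\<lambda>i. kpoint (p i))"
    unfolding assms(2) by (simp add: full_SetCompr_eq)
  have closed_Vp: "closedin zariski Vp" unfolding Vp by simp
  let ?comps = "irreducible_components zariski Vp"
  have Un: "\<Union>?comps = Vp"
    using closed_Vp by (intro Union_irreducible_components closedin_subset)
  have p_Vp: "kpoint (p i) \<in> Vp" for i
    unfolding Vp
    by (rule subsetD[OF closure_of_subset]) (auto simp: topspace_zariski kpoint_in_Spec)
  have mult: "{i. kpoint (w i) = v j} \<lesssim> {i. kpoint (p i) = v j}"
    if w: "case_prod w \<in> kpoints Y" and j: "j \<in> {1..s}" for w j
  proof (rule orbit_closure_isolated_lepoll)
    show "case_prod w \<in> kpoints (orbit_closure (kpoint (case_prod p)))"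
      using w unfolding assms(8) .
    have vj: "{v j} \<in> ?comps" using j unfolding assms(3) by blast
    let ?C = "\<Union>(?comps - {{v j}})"
    \<comment> \<open>A union of finitely many closed components.\<close>
    show "closedin zariski ?C"
      using closedin_irreducible_component[OF closed_Vp]
      by (intro closedin_Union) (auto simp: assms(3))
    show "v j \<in> Spec"
      using closedin_subset[OF assms(7)[OF j]] unfolding topspace_zariski by simp
    \<comment> \<open>By maximality of \<open>{v j}\<close>, a component containing
      \<open>v j\<close> is \<open>{v j}\<close> itself.\<close>
    show "v j \<notin> ?C"
      using vj unfolding irreducible_components_def by blast
    show "kpoint (p i) \<in> insert (v j) ?C" for i
      using p_Vp[of i] Un by blast
  qed
  have "case_prod w \<in> kpoints Y"
    if w: "\<And>i. w i \<in> kpoints Vp"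
      and le: "\<And>j. j \<in> {1..s} \<Longrightarrow> {i. kpoint (w i) = v j} \<lesssim> {i. kpoint (p i) = v j}" for w
    unfolding assms(8)
  proof (rule orbit_closureI[where \<P> = "v ` {1..s}"])
    show "{i. kpoint (w i) = P} \<lesssim> {i. kpoint (p i) = P}" if "P \<in> v ` {1..s}" for P
      using that le by blast
    fix i and F :: "nat set"
    assume F: "finite F" and i: "kpoint (w i) \<notin> v ` {1..s}"
    obtain S where S: "S \<in> ?comps" "kpoint (w i) \<in> S"
      using w[of i] Un unfolding kpoints_def by blast
    \<comment> \<open>\<open>S\<close> is not of the form \<open>{v j}\<close>, since that would
      force \<open>kpoint (w i) = v j\<close>; so it is one of the \<open>V\<close>
      components.\<close>
    then have "infinite (kpoints S)" using i assms(6) unfolding assms(3) by auto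
    then have "S \<subseteq> zariski closure_of ((\<lambda>k. kpoint (p k)) ` (- F))"
      using S(1) F unfolding irreducible_components_def Vp
      by (intro irreducible_in_cofinite_closure) auto
    with S(2) show "kpoint (w i) \<in> zariski closure_of ((\<lambda>k. kpoint (p k)) ` (- F))" by blast
  qed
  moreover have "w i \<in> kpoints Vp" if "case_prod w \<in> kpoints Y" for w i
    using that unfolding assms(8) Vp by (rule orbit_closure_imp_closure)
  ultimately show ?thesis using mult by blast
qed

end
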